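(* The following hold for every positive integer $k$: (a) Every $k$-growth system is $k$-extendible. (b) Every $k$-matchoid is a $k$-growth system.
   Context: An independence system $(S,\mathcal{I})$ is a finite set $S$ with a nonempty downward-closed family $\mathcal{I}\subseteq2^S$ of independent sets. A basis of $X\subseteq S$ is an inclusion-wise maximal independent subset of $X$. $k$-growth: for all $X\subseteq S$ and all $I\in\mathcal{I}$ there is a partition $(Q,Z)$ of $I\setminus X$ with $|Z|\le k|X\setminus I|$ such that $P\cup Q\in\mathcal{I}$ for every basis $P$ of $X$. $k$-extendible: for every $A\subseteq B\in\mathcal{I}$ and $e\in S\setminus B$ with $A\cup\{e\}\in\mathcal{I}$, there is $Z\subseteq B\setminus A$ with $|Z|\le k$ and $(B\cup\{e\})\setminus Z\in\mathcal{I}$. $k$-matchoid: there are matroids $(S_i,\mathcal{I}_i)$, $i\in[N]$, with $S=\bigcup_iS_i$, each $e\in S$ belonging to at most $k$ of the sets $S_i$, and $\mathcal{I}=\{F\subseteq S:F\cap S_i\in\mathcal{I}_i\ \forall i\in[N]\}$. *)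

theory Defs
  imports Main
begin

locale independence_system =
  fixes S :: "'a set" and J :: "'a set set"
  assumes finite_ground: "finite S"
    and indep_subset: "J \<subseteq> Pow S"
    and indep_nonempty: "J \<noteq> {}"
    and indep_downward: "B \<in> J \<Longrightarrow> A \<subseteq> B \<Longrightarrow> A \<in> J"

locale matroid = independence_system +
  assumes augment: "A \<in> J \<Longrightarrow> B \<in> J \<Longrightarrow> card A < card B \<Longrightarrow> \<exists>x\<in>B - A. insert x A \<in> J"

definition basis_of :: "'a set set \<Rightarrow> 'a set \<Rightarrow> 'a set \<Rightarrow> bool" where
  "basis_of J X P \<longleftrightarrow>
     P \<in> J \<and> P \<subseteq> X \<and> (\<forall>P'\<in>J. P \<subseteq> P' \<and> P' \<subseteq> X \<longrightarrow> P' = P)"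

text \<open>The parts of the partition may be empty, and the partition must not depend on the basis.\<close>

definition k_growth :: "nat \<Rightarrow> 'a set \<Rightarrow> 'a set set \<Rightarrow> bool" where
  "k_growth k S J \<longleftrightarrow> independence_system S J \<and>
     (\<forall>X I. X \<subseteq> S \<and> I \<in> J \<longrightarrow>
        (\<exists>Q Z. Q \<union> Z = I - X \<and> Q \<inter> Z = {} \<and> card Z \<le> k * card (X - I) \<and>
           (\<forall>P. basis_of J X P \<longrightarrow> P \<union> Q \<in> J)))"

definition k_extendible :: "nat \<Rightarrow> 'a set \<Rightarrow> 'a set set \<Rightarrow> bool" where
  "k_extendible k S J \<longleftrightarrow> independence_system S J \<and>
     (\<forall>A B e. A \<subseteq> B \<and> B \<in> J \<and> e \<in> S - B \<and> A \<union> {e} \<in> J \<longrightarrow>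
        (\<exists>Z. Z \<subseteq> B - A \<and> card Z \<le> k \<and> (B \<union> {e}) - Z \<in> J))"

text \<open>That a matchoid is an independence system follows from the matroid axioms of its parts,
  so it is not required separately.\<close>

definition k_matchoid :: "nat \<Rightarrow> 'a set \<Rightarrow> 'a set set \<Rightarrow> bool" where
  "k_matchoid k S J \<longleftrightarrow>
     (\<exists>(N :: nat) (T :: nat \<Rightarrow> 'a set) (L :: nat \<Rightarrow> 'a set set).
        (\<forall>i\<in>{1..N}. matroid (T i) (L i)) \<and>
        S = (\<Union>i\<in>{1..N}. T i) \<and>
        (\<forall>e\<in>S. card {i \<in> {1..N}. e \<in> T i} \<le> k) \<and>
        J = {F. F \<subseteq> S \<and> (\<forall>i\<in>{1..N}. F \<inter> T i \<in> L i)})"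

lemma k_matchoid_independence_system:
  assumes "k_matchoid k S J"
  shows "independence_system S J"
proof -
  obtain N :: nat and T L where M: "\<forall>i\<in>{1..N}. matroid (T i) (L i)"
    and S: "S = (\<Union>i\<in>{1..N}. T i)"
    and J: "J = {F. F \<subseteq> S \<and> (\<forall>i\<in>{1..N}. F \<inter> T i \<in> L i)}"
    using assms unfolding k_matchoid_def by blast
  have I: "independence_system (T i) (L i)" if "i \<in> {1..N}" for i
    using M that by (auto simp: matroid_def)
  have empty: "{} \<in> L i" if "i \<in> {1..N}" for i
    using independence_system.indep_nonempty[OF I[OF that]]
      independence_system.indep_downward[OF I[OF that]] by blast
  show ?thesis
  proof
    show "finite S"
      using independence_system.finite_ground[OF I] by (auto simp: S)
    show "J \<subseteq> Pow S" by (auto simp: J)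
    show "J \<noteq> {}" using empty by (auto simp: J)
    show "A \<in> J" if "B \<in> J" "A \<subseteq> B" for A B
      unfolding J
    proof (intro CollectI conjI ballI)
      show "A \<subseteq> S" using that by (auto simp: J)
      fix i assume i: "i \<in> {1..N}"
      then have "B \<inter> T i \<in> L i" using that by (auto simp: J)
      then show "A \<inter> T i \<in> L i"
        by (rule independence_system.indep_downward[OF I[OF i]]) (use that in blast)
    qed
  qed
qed

end

theory Submission imports Defs begin

text \<open>
  For (a), apply \<open>k\<close>-growth to \<open>X = A \<union> {e}\<close>, which is its own only basis, and \<open>I = B\<close>.

  For (b), first consider a single matroid. Extend \<open>I \<inter> X\<close> to a basis \<open>B\<close> of \<open>X\<close>, extend \<open>B\<close> by
  elements of \<open>I\<close> to \<open>B \<union> Q\<close> of size at least \<open>|I|\<close>, and let \<open>Z\<close> be the rest of \<open>I - X\<close>.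
  Then \<open>|Z| \<le> |B - I| \<le> |X - I|\<close>. Extending any independent \<open>P \<subseteq> X\<close> by elements of \<open>B \<union> Q\<close> up to
  the size of \<open>B \<union> Q\<close> must use all of \<open>Q\<close>, because at most \<open>|B|\<close> elements can lie in \<open>X\<close>. So
  \<open>P \<union> Q\<close> is independent for every independent \<open>P \<subseteq> X\<close>, not only for bases. This matters because
  the trace on \<open>S\<^sub>i\<close> of a basis of the matchoid need not be a basis in the \<open>i\<close>-th matroid.
  In a matchoid, remove from \<open>I - X\<close> the union of the sets \<open>Z\<^sub>i\<close> obtained from the matroids;
  double counting gives \<open>|Z| \<le> \<Sum>\<^sub>i |(X - I) \<inter> S\<^sub>i| \<le> k |X - I|\<close>.
\<close>

lemma (in independence_system) finite_indep: "A \<in> J \<Longrightarrow> finite A"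
  using finite_ground indep_subset by (meson PowD finite_subset subsetD)

text \<open>Repeated augmentation of \<open>A\<close> by elements of \<open>B\<close>. The size
  bound is an inequality because \<open>A\<close> may already be larger than
  \<open>B\<close>.\<close>

lemma (in matroid) extend_indep:
  assumes "A \<in> J" "B \<in> J"
  obtains D where "D \<in> J" "A \<subseteq> D" "D \<subseteq> A \<union> B" "card B \<le> card D"
proof -
  have "\<exists>D\<in>J. A \<subseteq> D \<and> D \<subseteq> A \<union> B \<and> card B \<le> card D"
    using assms(1)
  proof (induction "card B - card A" arbitrary: A rule: less_induct)
    case less
    show ?case
    proof (cases "card A < card B")
      case False
      then show ?thesis using less.prems by force
    next
      case True
      then obtain x where x: "x \<in> B - A" "insert x A \<in> J"
        using augment less.prems assms(2) by blast
      have "card B - card (insert x A) < card B - card A"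
        using True x(1) finite_indep[OF less.prems] by simp
      from less.hyps[OF this x(2)] show ?thesis using x(1) by blast
    qed
  qed
  then show thesis using that by blast
qed

text \<open>\<open>X\<close> is an arbitrary set, so that one \<open>X\<close> can serve all
  matroids of a matchoid; the bound counts only its part inside \<open>S\<close>.\<close>

lemma (in matroid) matroid_growth:
  assumes I: "I \<in> J"
  obtains Z where "Z \<subseteq> I - X" "card Z \<le> card (X \<inter> S - I)"
    "\<And>P. P \<in> J \<Longrightarrow> P \<subseteq> X \<Longrightarrow> P \<union> (I - X - Z) \<in> J"
proof -
  define F where "F = {C \<in> J. C \<subseteq> X}"
  have IX: "I \<inter> X \<in> J" using indep_downward[OF I] by blast
  have "finite J" using finite_ground indep_subset by (meson finite_Pow_iff finite_subset)
  then have "finite F" "F \<noteq> {}" using IX by (auto simp: F_def)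
  \<comment> \<open>\<open>C\<close> is a largest independent subset of \<open>X\<close>; extending
    \<open>I \<inter> X\<close> by elements of \<open>C\<close> yields \<open>B\<close> of full rank
    in \<open>X\<close>.\<close>
  then obtain C where "C \<in> F" "card C = Max (card ` F)"
    using Max_in[of "card ` F"] by fastforce
  then have C: "C \<in> F" "\<And>C'. C' \<in> F \<Longrightarrow> card C' \<le> card C"
    using \<open>finite F\<close> by simp_all
  obtain B where B: "B \<in> J" "I \<inter> X \<subseteq> B" "B \<subseteq> (I \<inter> X) \<union> C" "card C \<le> card B"
    using extend_indep[OF IX, of C] C(1) by (auto simp: F_def)
  have BX: "B \<subseteq> X" using B(3) C(1) by (auto simp: F_def)
  have rank: "card C' \<le> card B" if "C' \<in> J" "C' \<subseteq> X" for C'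
    using C(2)[of C'] that B(4) by (auto simp: F_def)
  obtain D where D: "D \<in> J" "B \<subseteq> D" "D \<subseteq> B \<union> I" "card I \<le> card D"
    using extend_indep[OF B(1) I] .
  define Q where "Q = D - B"
  have Q: "Q \<subseteq> I - X" using D(3) B(2) by (auto simp: Q_def)
  have fin: "finite I" "finite B" "finite D" "finite Q" using finite_indep I B(1) D(1)
    by (auto simp: Q_def)
  have cardD: "card D = card B + card Q"
    using card_Un_disjoint[of B Q] fin D(2) by (simp add: Q_def card_Diff_subset card_mono)
  show thesis
  proof (rule that[of "I - X - Q"])
    \<comment> \<open>|I - X - Q| = |I| - |I \<inter> X| - |Q| \<le> |D| - |Q| - |I \<inter> X| =
      |B| - |I \<inter> X| = |B - I|.\<close>
    have "card (I - X - Q) + card Q = card (I - X)"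
      using card_Diff_subset[OF fin(4) Q] card_mono[OF _ Q] fin(1) by simp
    moreover have "card (I - X) + card (I \<inter> X) = card I"
      using card_Int_Diff[OF fin(1), of X] by simp
    moreover have "card (B - I) + card (I \<inter> X) = card B"
    proof -
      have "B \<inter> I = I \<inter> X" using B(2) BX by blast
      then show ?thesis using card_Int_Diff[OF fin(2), of I] by simp
    qed
    moreover have "card (B - I) \<le> card (X \<inter> S - I)"
      using BX B(1) indep_subset finite_ground by (intro card_mono) auto
    ultimately show "card (I - X - Q) \<le> card (X \<inter> S - I)" using D(4) cardD by linarith
  next
    fix P assume P: "P \<in> J" "P \<subseteq> X"
    obtain E where E: "E \<in> J" "P \<subseteq> E" "E \<subseteq> P \<union> D" "card D \<le> card E"
      using extend_indep[OF P(1) D(1)] .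
    have "E - X \<subseteq> Q" using E(3) P(2) BX by (auto simp: Q_def)
    moreover have "card E = card (E \<inter> X) + card (E - X)"
      using card_Int_Diff finite_indep[OF E(1)] by blast
    moreover have "card (E \<inter> X) \<le> card B" using rank indep_downward[OF E(1)] by blast
    ultimately have "E - X = Q"
      using E(4) cardD fin(4) by (intro card_seteq) auto
    then have "P \<union> (I - X - (I - X - Q)) \<subseteq> E" using E(2) by blast
    then show "P \<union> (I - X - (I - X - Q)) \<in> J" using indep_downward[OF E(1)] by blast
  qed blast
qed

lemma k_growth_imp_k_extendible:
  assumes "k_growth k S J"
  shows "k_extendible k S J"
  unfolding k_extendible_def
proof (intro conjI allI impI; (elim conjE)?)
  show IS: "independence_system S J" using assms by (simp add: k_growth_def)
  fix A B e assume H: "A \<subseteq> B" "B \<in> J" "e \<in> S - B" "A \<union> {e} \<in> J"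
  have "A \<union> {e} \<subseteq> S" using H(4) independence_system.indep_subset[OF IS] by blast
  with assms H(2) obtain Q Z where QZ: "Q \<union> Z = B - (A \<union> {e})" "Q \<inter> Z = {}"
    "card Z \<le> k * card (A \<union> {e} - B)" "\<forall>P. basis_of J (A \<union> {e}) P \<longrightarrow> P \<union> Q \<in> J"
    unfolding k_growth_def by meson
  \<comment> \<open>Only \<open>e\<close> is new to \<open>B\<close>, so the growth bound becomes
    \<open>k * 1\<close>.\<close>
  have "A \<union> {e} - B = {e}" using H by blast
  then have "card Z \<le> k" using QZ(3) by simp
  moreover have "A \<union> {e} \<union> Q \<in> J" using QZ(4) H(4) by (auto simp: basis_of_def)
  moreover have "A \<union> {e} \<union> Q = (B \<union> {e}) - Z" using QZ(1,2) H by blast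
  ultimately show "\<exists>Z. Z \<subseteq> B - A \<and> card Z \<le> k \<and> (B \<union> {e}) - Z \<in> J"
    using QZ(1) by (intro exI[of _ Z]) auto
qed

text \<open>Count the pairs \<open>(e, i)\<close> with \<open>e \<in> Y \<inter> T i\<close> first
  by \<open>i\<close>, then by \<open>e\<close>.\<close>

lemma sum_card_Int_le:
  assumes "finite A" "finite Y" "\<And>e. e \<in> Y \<Longrightarrow> card {i \<in> A. e \<in> T i} \<le> k"
  shows "(\<Sum>i\<in>A. card (Y \<inter> T i)) \<le> k * card Y"
proof -
  have "(\<Sum>i\<in>A. card {e \<in> Y. e \<in> T i}) = (\<Sum>e\<in>Y. card {i \<in> A. e \<in> T i})"
    using assms(1,2) by (intro sum_multicount_gen) auto
  also have "\<dots> \<le> card Y * k" using assms(3) sum_bounded_above[of Y _ k] by simp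
  finally show ?thesis by (simp add: Int_def mult.commute)
qed

lemma k_matchoid_imp_k_growth:
  assumes "k_matchoid k S J"
  shows "k_growth k S J"
  unfolding k_growth_def
proof (intro conjI allI impI)
  show IS: "independence_system S J" by (rule k_matchoid_independence_system[OF assms])
  obtain N :: nat and T L where M: "\<And>i. i \<in> {1..N} \<Longrightarrow> matroid (T i) (L i)"
    and S: "S = (\<Union>i\<in>{1..N}. T i)"
    and mult: "\<And>e. e \<in> S \<Longrightarrow> card {i \<in> {1..N}. e \<in> T i} \<le> k"
    and J: "J = {F. F \<subseteq> S \<and> (\<forall>i\<in>{1..N}. F \<inter> T i \<in> L i)}"
    using assms unfolding k_matchoid_def by blast
  fix X I assume XI: "X \<subseteq> S \<and> I \<in> J"
  have "\<exists>Z. Z \<subseteq> I \<inter> T i - X \<and> card Z \<le> card ((X - I) \<inter> T i) \<and>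
          (\<forall>P. P \<in> L i \<and> P \<subseteq> X \<longrightarrow> P \<union> (I \<inter> T i - X - Z) \<in> L i)" if i: "i \<in> {1..N}" for i
  proof -
    interpret matroid "T i" "L i" by (rule M[OF i])
    have "I \<inter> T i \<in> L i" using XI i by (auto simp: J)
    then obtain Z where "Z \<subseteq> I \<inter> T i - X" "card Z \<le> card (X \<inter> T i - I \<inter> T i)"
      "\<And>P. P \<in> L i \<Longrightarrow> P \<subseteq> X \<Longrightarrow> P \<union> (I \<inter> T i - X - Z) \<in> L i"
      using matroid_growth by metis
    moreover have "X \<inter> T i - I \<inter> T i = (X - I) \<inter> T i" by blast
    ultimately show ?thesis by auto
  qed
  \<comment> \<open>Each \<open>Z i\<close> is fixed before \<open>P\<close>, so their union does
    not depend on the basis.\<close>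
  then obtain Z where Z: "\<And>i. i \<in> {1..N} \<Longrightarrow> Z i \<subseteq> I \<inter> T i - X"
    "\<And>i. i \<in> {1..N} \<Longrightarrow> card (Z i) \<le> card ((X - I) \<inter> T i)"
    "\<And>i P. i \<in> {1..N} \<Longrightarrow> P \<in> L i \<Longrightarrow> P \<subseteq> X \<Longrightarrow> P \<union> (I \<inter> T i - X - Z i) \<in> L i"
    by metis
  define ZZ where "ZZ = (\<Union>i\<in>{1..N}. Z i)"
  have "card ZZ \<le> (\<Sum>i\<in>{1..N}. card (Z i))"
    unfolding ZZ_def by (rule card_UN_le) simp
  also have "\<dots> \<le> (\<Sum>i\<in>{1..N}. card ((X - I) \<inter> T i))" using Z(2) by (rule sum_mono)
  also have "\<dots> \<le> k * card (X - I)"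
    using XI independence_system.finite_ground[OF IS] mult
    by (intro sum_card_Int_le) (auto dest: finite_subset)
  finally have "card ZZ \<le> k * card (X - I)" .
  moreover have "P \<union> (I - X - ZZ) \<in> J" if "basis_of J X P" for P
    unfolding J
  proof (intro CollectI conjI ballI)
    have P: "P \<in> J" "P \<subseteq> X" using that by (auto simp: basis_of_def)
    show "P \<union> (I - X - ZZ) \<subseteq> S" using P XI by (auto simp: J)
    fix i assume i: "i \<in> {1..N}"
    interpret matroid "T i" "L i" by (rule M[OF i])
    have "P \<inter> T i \<in> L i" using P(1) i by (auto simp: J)
    then have "P \<inter> T i \<union> (I \<inter> T i - X - Z i) \<in> L i" using P(2) Z(3)[OF i] by blast
    \<comment> \<open>As \<open>Z i \<subseteq> ZZ\<close>, removing all of \<open>ZZ\<close> only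
      shrinks the trace on \<open>T i\<close>, and downward closure applies.\<close>
    moreover have "(P \<union> (I - X - ZZ)) \<inter> T i \<subseteq> P \<inter> T i \<union> (I \<inter> T i - X - Z i)"
      using i by (auto simp: ZZ_def)
    ultimately show "(P \<union> (I - X - ZZ)) \<inter> T i \<in> L i" by (rule indep_downward)
  qed
  moreover have "ZZ \<subseteq> I - X" using Z(1) by (fastforce simp: ZZ_def)
  ultimately show "\<exists>Q Z. Q \<union> Z = I - X \<and> Q \<inter> Z = {} \<and> card Z \<le> k * card (X - I) \<and>
      (\<forall>P. basis_of J X P \<longrightarrow> P \<union> Q \<in> J)"
    by (intro exI[of _ "I - X - ZZ"] exI[of _ ZZ]) auto
qed

theorem theorem10:
  fixes k :: nat
  assumes "k > 0"
  shows "(\<forall>(S :: 'a set) (J :: 'a set set). k_growth k S J \<longrightarrow> k_extendible k S J) \<and>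
         (\<forall>(S :: 'a set) (J :: 'a set set). k_matchoid k S J \<longrightarrow> k_growth k S J)"
  using k_growth_imp_k_extendible k_matchoid_imp_k_growth by blast

end
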